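(* If the index $s$ defined in the context satisfies $N-s+1<s$, then, with probability at least $1-\alpha$ over the sample, the set $$\mathcal{U}^M_\epsilon=\big\{\mathbf{u}\in\mathbb{R}^d:\hat u_i^{(N-s+1)}\le u_i\le\hat u_i^{(s)},\ i=1,\dots,d\big\}$$ implies a probabilistic guarantee for $\mathbb{P}^*$ at level $\epsilon$. Moreover, $$\delta^*(\mathbf{v}\mid\mathcal{U}^M_\epsilon)=\sum_{i=1}^d\max\big(v_i\hat u_i^{(N-s+1)},\,v_i\hat u_i^{(s)}\big).$$
   Context: $0<\alpha<1$, $0<\epsilon<1$. $\mathbb{P}^*$ is an unknown measure on $\mathbb{R}^d$ (components not assumed independent) supported in a known finite box $\{\mathbf{u}:\hat u_i^{(0)}\le u_i\le\hat u_i^{(N+1)},\ i=1,\dots,d\}$. For each $i$ we observe $N$ i.i.d. samples from the marginal $\mathbb{P}_i^*$ (samples of different marginals may be drawn separately, with no assumption on their joint law); $\hat u_i^{(j)}$, $1\le j\le N$, is the $j$-th order statistic (increasing order) of the samples of marginal $i$. The index $s$ is $$s=\min\Big\{k\in\mathbb{N}:\sum_{j=k}^N\binom Nj(\epsilon/d)^{N-j}(1-\epsilon/d)^j\le\frac\alpha{2d}\Big\},$$ where $k$ ranges over $\{1,\dots,N\}$, and $s=N+1$ if the corresponding set is empty. $\delta^*(\mathbf{v}\mid\mathcal{U})=\sup_{\mathbf{u}\in\mathcal{U}}\mathbf{v}^T\mathbf{u}$. A set $\mathcal{U}$ implies a probabilistic guarantee for $\mathbb{P}^*$ at level $\epsilon$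 if for every $\mathbf{x}^*\in\mathbb{R}^k$ and every real-valued $f(\mathbf{u},\mathbf{x})$ concave in $\mathbf{u}$ for all $\mathbf{x}$: $f(\mathbf{u},\mathbf{x}^* )\le0\ \forall\mathbf{u}\in\mathcal{U}$ implies $\mathbb{P}^*(f(\tilde{\mathbf{u}},\mathbf{x}^* )\le0)\ge1-\epsilon$, where $\tilde{\mathbf{u}}\sim\mathbb{P}^*$. *)

theory Defs
  imports "HOL-Probability.Probability"
begin

definition marginal :: "(real ^ 'n) measure \<Rightarrow> 'n::finite \<Rightarrow> real measure" where
  "marginal P i = distr P borel (\<lambda>u. u $ i)"

text \<open>The observations are \<open>x 1, \<dots>, x N\<close>; the ranks \<open>0\<close> and \<open>N + 1\<close> denote the known
  bounds \<open>l\<close> and \<open>h\<close> of the support.\<close>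

definition order_stat :: "real \<Rightarrow> real \<Rightarrow> nat \<Rightarrow> (nat \<Rightarrow> real) \<Rightarrow> nat \<Rightarrow> real" where
  "order_stat l h N x j =
     (if j = 0 then l else if j = N + 1 then h else sort (map x [1..<N + 1]) ! (j - 1))"

definition s_index :: "real \<Rightarrow> real \<Rightarrow> nat \<Rightarrow> nat \<Rightarrow> nat" where
  "s_index \<alpha> \<epsilon> d N =
     (let K = {k \<in> {1..N}.
          (\<Sum>j=k..N. real (N choose j) * (\<epsilon> / real d) ^ (N - j) * (1 - \<epsilon> / real d) ^ j)
            \<le> \<alpha> / (2 * real d)}
      in if K = {} then N + 1 else Min K)"

text \<open>The rank \<open>N - s + 1\<close> is written \<open>N + 1 - s\<close>: for \<open>s = N + 1\<close> it must be \<open>0\<close>,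
  whereas truncated subtraction would make \<open>N - s + 1\<close> equal to \<open>1\<close>.\<close>

definition U_M ::
  "real ^ 'n \<Rightarrow> real ^ 'n \<Rightarrow> nat \<Rightarrow> nat \<Rightarrow> ('n \<Rightarrow> nat \<Rightarrow> real) \<Rightarrow> (real ^ 'n::finite) set" where
  "U_M lo hi N s x =
     {u. \<forall>i. order_stat (lo $ i) (hi $ i) N (x i) (N + 1 - s) \<le> u $ i \<and>
             u $ i \<le> order_stat (lo $ i) (hi $ i) N (x i) s}"

text \<open>The supremum is taken in the extended reals, so that it is meaningful for every set.\<close>

definition support_fun :: "real ^ 'n::finite \<Rightarrow> (real ^ 'n) set \<Rightarrow> ereal" where
  "support_fun v U = (SUP u\<in>U. ereal (v \<bullet> u))"

text \<open>The type argument fixes the space \<open>real ^ 'k\<close> of the decision variable.\<close>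

definition implies_guarantee ::
  "'k::finite itself \<Rightarrow> (real ^ 'n::finite) measure \<Rightarrow> real \<Rightarrow> (real ^ 'n) set \<Rightarrow> bool" where
  "implies_guarantee (_ :: 'k itself) P \<epsilon> U \<longleftrightarrow>
     (\<forall>(x :: real ^ 'k) (f :: real ^ 'n \<Rightarrow> real ^ 'k \<Rightarrow> real).
        (\<forall>y. concave_on UNIV (\<lambda>u. f u y)) \<longrightarrow>
        (\<forall>u\<in>U. f u x \<le> 0) \<longrightarrow>
        \<P>(u in P. f u x \<le> 0) \<ge> 1 - \<epsilon>)"

end

theory Submission
  imports Defs
begin

text \<open>
  Two separate ideas meet at the \<^emph>\<open>halfspace criterion\<close>. A concave \<open>g\<close> that is nonpositive on a
  compact box \<open>U\<close> is positive on an open convex set disjoint from \<open>U\<close>, and a separating hyperplane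
  puts that set inside an open halfspace \<open>v \<bullet> u > \<delta>\<^sup>*(v | U)\<close>. As affine functions are concave,
  \<open>U\<close> implies the guarantee at level \<open>\<epsilon>\<close> exactly when each of these halfspaces has probability at
  most \<open>\<epsilon>\<close> (\<open>implies_guarantee_cbox_iff\<close>). The decision variable disappears altogether.

  \<^emph>\<open>The criterion from the marginals.\<close> For a box the support function is a sum over coordinates, so
  \<open>v \<bullet> u > \<delta>\<^sup>*(v | U)\<close> forces some summand \<open>v\<^sub>i u\<^sub>i\<close> above its own maximum, that is, \<open>u\<^sub>i\<close> beyond one
  endpoint of its interval, the sign of \<open>v\<^sub>i\<close> saying which. A union bound over the \<open>d\<close> coordinates
  therefore needs only that each marginal has mass at most \<open>\<epsilon>/d\<close> on either side of its interval,
  whatever the dependence between coordinates (\<open>halfspace_prob_le_if_marginal_tails\<close>).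

  \<^emph>\<open>The marginals from the sample.\<close> The upper endpoint is bad when it lies in the down-closed set \<open>D\<close>
  of points with upper tail larger than \<open>\<epsilon>/d\<close>. This set has probability at most \<open>1 - \<epsilon>/d\<close>, also for
  distributions with atoms. The \<open>s\<close>-th order statistic lies in \<open>D\<close> iff at least \<open>s\<close> of the \<open>N\<close>
  observations do, which is a binomial event, and monotonicity of the binomial tail in the success
  probability bounds it by the sum that defines \<open>s\<close>, hence by \<open>\<alpha>/(2d)\<close>
  (\<open>prob_order_stat_downset_le\<close>). The lower endpoint is the mirror image. There are \<open>2d\<close> endpoints, so by
  a union bound, whatever the joint law of the samples of different marginals, some endpoint is bad
  with probability at most \<open>\<alpha>\<close>.
  For \<open>s = N + 1\<close> the endpoints are the known bounds of the support and are never bad.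

  The event that the guarantee holds quantifies over all concave functions, and it must be shown to
  be measurable before its probability means anything. The halfspace criterion settles this too:
  the pairs of corners of the boxes that satisfy it form a closed set (\<open>closed_halfspace_guarantee\<close>),
  and order statistics are measurable.
\<close>

section \<open>Upper tails of the binomial distribution\<close>

definition binomial_tail :: "nat \<Rightarrow> real \<Rightarrow> nat \<Rightarrow> real" where
  "binomial_tail n p k = (\<Sum>j=k..n. real (n choose j) * (1 - p) ^ (n - j) * p ^ j)"

lemma binomial_tail_0: "binomial_tail n p 0 = 1"
proof -
  have "binomial_tail n p 0 = (p + (1 - p)) ^ n"
    unfolding binomial_tail_def binomial_ring
    by (intro sum.cong) (auto simp: atLeast0AtMost mult_ac)
  then show ?thesis by simp
qed

text \<open>Conditioning on the last of \<open>n + 1\<close> trials; algebraically, Pascal's rule.\<close>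

lemma binomial_tail_Suc:
  "binomial_tail (Suc n) p (Suc k) = p * binomial_tail n p k + (1 - p) * binomial_tail n p (Suc k)"
proof -
  let ?t = "\<lambda>j. real (n choose j) * (1 - p) ^ (Suc n - j) * p ^ j"
  have "binomial_tail (Suc n) p (Suc k)
      = (\<Sum>i=k..n. real (Suc n choose Suc i) * (1 - p) ^ (n - i) * p ^ Suc i)"
    unfolding binomial_tail_def by (subst sum.shift_bounds_cl_Suc_ivl) simp
  also have "\<dots> = (\<Sum>i=k..n. p * (real (n choose i) * (1 - p) ^ (n - i) * p ^ i) + ?t (Suc i))"
    by (intro sum.cong refl) (simp add: algebra_simps)
  also have "\<dots> = p * binomial_tail n p k + (\<Sum>j=Suc k..Suc n. ?t j)"
    unfolding binomial_tail_def sum.distrib sum_distrib_left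
    by (subst sum.shift_bounds_cl_Suc_ivl) simp
  also have "(\<Sum>j=Suc k..Suc n. ?t j) = (\<Sum>j=Suc k..n. ?t j)"
    by (rule sum.mono_neutral_right) (auto simp: le_Suc_eq)
  also have "\<dots> = (1 - p) * binomial_tail n p (Suc k)"
    unfolding binomial_tail_def sum_distrib_left
    by (intro sum.cong refl) (auto simp: Suc_diff_le)
  finally show ?thesis .
qed

text \<open>By the recursion, the tail for \<open>n + 1\<close> trials is a mixture, with weight \<open>p\<close> on the larger, of the
  tails for \<open>n\<close> trials at \<open>k\<close> and at \<open>k + 1\<close>. Raising \<open>p\<close> raises both tails, by induction, and shifts
  weight to the larger one.\<close>

lemma binomial_tail_mono:
  assumes "0 \<le> p" "p \<le> q" "q \<le> 1"
  shows "binomial_tail n p k \<le> binomial_tail n q k"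
proof (induction n arbitrary: k)
  case 0
  show ?case using assms by (cases k) (simp_all add: binomial_tail_0, simp add: binomial_tail_def)
next
  case (Suc n)
  show ?case
  proof (cases k)
    case 0
    then show ?thesis by (simp add: binomial_tail_0)
  next
    case (Suc m)
    have antimono: "binomial_tail n q (Suc m) \<le> binomial_tail n q m"
      unfolding binomial_tail_def using assms by (intro sum_mono2) auto
    have "binomial_tail (Suc n) p k
        = p * binomial_tail n p m + (1 - p) * binomial_tail n p (Suc m)"
      by (simp add: Suc binomial_tail_Suc)
    also have "\<dots> \<le> p * binomial_tail n q m + (1 - p) * binomial_tail n q (Suc m)"
      using assms by (intro add_mono mult_left_mono Suc.IH) auto
    also have "\<dots> = binomial_tail n q (Suc m) + p * (binomial_tail n q m - binomial_tail n q (Suc m))"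
      by (simp add: algebra_simps)
    also have "\<dots> \<le> binomial_tail n q (Suc m) + q * (binomial_tail n q m - binomial_tail n q (Suc m))"
      using assms antimono by (intro add_left_mono mult_right_mono) auto
    also have "\<dots> = binomial_tail (Suc n) q k"
      by (simp add: Suc binomial_tail_Suc algebra_simps)
    finally show ?thesis .
  qed
qed

text \<open>The event is split according to the exact set \<open>J\<close> of indices whose variable falls in \<open>A\<close>: the parts
  are disjoint, and independence gives each of them the probability \<open>p ^ |J| * (1 - p) ^ (|I| - |J|)\<close>.\<close>

lemma (in prob_space) prob_count_eq_binomial_tail:
  assumes indep: "indep_vars (\<lambda>_. N) X I" and I: "finite I" and A: "A \<in> sets N"
    and p: "\<And>j. j \<in> I \<Longrightarrow> prob (X j -` A \<inter> space M) = p"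
  shows "prob {\<omega> \<in> space M. k \<le> card {j \<in> I. X j \<omega> \<in> A}} = binomial_tail (card I) p k"
proof -
  have rv: "X j \<in> measurable M N" if "j \<in> I" for j
    using indep that by (auto simp: indep_vars_def)
  define B where "B J = {\<omega> \<in> space M. {j \<in> I. X j \<omega> \<in> A} = J}" for J
  \<comment> \<open>The intersection with \<open>space M\<close> matters only for empty \<open>I\<close>.\<close>
  have B_Int: "B J = space M \<inter> (\<Inter>j\<in>I. X j -` (if j \<in> J then A else space N - A) \<inter> space M)"
    if "J \<subseteq> I" for J
    using that measurable_space[OF rv] by (auto simp: B_def split: if_splits)
  have B_sets: "B J \<in> events" if "J \<subseteq> I" for J
  proof (cases "I = {}")
    case True
    then show ?thesis using that by (simp add: B_def)
  next
    case False
    have "X j -` (if j \<in> J then A else space N - A) \<inter> space M \<in> events" if "j \<in> I" for j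
      using A by (intro measurable_sets[OF rv[OF that]]) auto
    then show ?thesis
      unfolding B_Int[OF that] by (rule sets.Int[OF sets.top sets.finite_INT[OF I False]])
  qed
  have prob_B: "prob (B J) = p ^ card J * (1 - p) ^ (card I - card J)" if J: "J \<subseteq> I" for J
  proof (cases "I = {}")
    case True
    then show ?thesis using J by (simp add: B_def prob_space)
  next
    case False
    have "B J = (\<Inter>j\<in>I. X j -` (if j \<in> J then A else space N - A) \<inter> space M)"
      using B_Int[OF J] False by auto
    then have "prob (B J) = (\<Prod>j\<in>I. prob (X j -` (if j \<in> J then A else space N - A) \<inter> space M))"
      using indep_varsD_finite[OF indep False I, of "\<lambda>j. if j \<in> J then A else space N - A"] A by simp
    also have "\<dots> = (\<Prod>j\<in>I. if j \<in> J then p else 1 - p)"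
    proof (intro prod.cong refl)
      fix j assume j: "j \<in> I"
      have "X j -` (space N - A) \<inter> space M = space M - (X j -` A \<inter> space M)"
        using measurable_space[OF rv[OF j]] by auto
      then have "prob (X j -` (space N - A) \<inter> space M) = 1 - p"
        using prob_compl[OF measurable_sets[OF rv[OF j] A]] p[OF j] by simp
      then show "prob (X j -` (if j \<in> J then A else space N - A) \<inter> space M)
          = (if j \<in> J then p else 1 - p)"
        using p[OF j] by simp
    qed
    also have "\<dots> = p ^ card J * (1 - p) ^ (card I - card J)"
      using I J by (simp add: prod.If_cases Int_absorb1 Diff_eq[symmetric] card_Diff_subset finite_subset)
    finally show ?thesis .
  qed
  let ?T = "{J \<in> Pow I. k \<le> card J}"
  have "{\<omega> \<in> space M. k \<le> card {j \<in> I. X j \<omega> \<in> A}} = (\<Union>J\<in>?T. B J)"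
    by (auto simp: B_def)
  then have "prob {\<omega> \<in> space M. k \<le> card {j \<in> I. X j \<omega> \<in> A}} = (\<Sum>J\<in>?T. prob (B J))"
    using I B_sets
    by (simp only:, intro finite_measure_finite_Union) (auto simp: B_def disjoint_family_on_def)
  also have "\<dots> = (\<Sum>J\<in>?T. p ^ card J * (1 - p) ^ (card I - card J))"
    by (intro sum.cong refl prob_B) auto
  also have "\<dots> = (\<Sum>m=k..card I. \<Sum>J | J \<in> ?T \<and> card J = m. p ^ card J * (1 - p) ^ (card I - card J))"
    using I by (intro sum.group[symmetric]) (auto intro: card_mono)
  also have "\<dots> = binomial_tail (card I) p k"
    unfolding binomial_tail_def
  proof (intro sum.cong refl)
    fix m assume m: "m \<in> {k..card I}"
    then have "{J. J \<in> ?T \<and> card J = m} = {J. J \<subseteq> I \<and> card J = m}" by auto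
    then show "(\<Sum>J | J \<in> ?T \<and> card J = m. p ^ card J * (1 - p) ^ (card I - card J))
        = real (card I choose m) * (1 - p) ^ (card I - m) * p ^ m"
      using n_subsets[OF I, of m] by simp
  qed
  finally show ?thesis .
qed

section \<open>Order statistics\<close>

text \<open>In a sorted list the elements of a down-closed set occupy an initial segment, whose length is their
  number.\<close>

lemma sort_nth_in_downset_iff:
  fixes xs :: "'a::linorder list"
  assumes down: "\<And>y z. y \<le> z \<Longrightarrow> z \<in> D \<Longrightarrow> y \<in> D" and k: "k < length xs"
  shows "sort xs ! k \<in> D \<longleftrightarrow> k < length (filter (\<lambda>y. y \<in> D) xs)"
proof -
  let ?S = "{i. i < length (sort xs) \<and> sort xs ! i \<in> D}"
  have "length (filter (\<lambda>y. y \<in> D) xs) = length (filter (\<lambda>y. y \<in> D) (sort xs))"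
    using arg_cong[OF filter_sort[of "\<lambda>y. y \<in> D" "\<lambda>y. y" xs], of length] by simp
  then have len: "length (filter (\<lambda>y. y \<in> D) xs) = card ?S"
    by (simp only: length_filter_conv_card)
  have down_nth: "sort xs ! i \<in> D" if "i \<le> j" "j < length xs" "sort xs ! j \<in> D" for i j
    using down[OF sorted_nth_mono[OF sorted_sort that(1)]] that(2,3) by simp
  show ?thesis
  proof
    assume "sort xs ! k \<in> D"
    then have "{..k} \<subseteq> ?S" using down_nth[OF _ k] k by auto
    then have "card {..k} \<le> card ?S" by (intro card_mono) auto
    then show "k < length (filter (\<lambda>y. y \<in> D) xs)" unfolding len by simp
  next
    assume *: "k < length (filter (\<lambda>y. y \<in> D) xs)"
    show "sort xs ! k \<in> D"
    proof (rule ccontr)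
      assume "sort xs ! k \<notin> D"
      then have "i < k" if "i \<in> ?S" for i using down_nth[of k i] that by (cases "k \<le> i") auto
      then have "?S \<subseteq> {..<k}" by blast
      then have "card ?S \<le> card {..<k}" by (intro card_mono) auto
      then show False using * unfolding len by simp
    qed
  qed
qed

lemma order_stat_eq_nth_sort:
  assumes "1 \<le> k" "k \<le> N"
  shows "order_stat l h N x k = sort (map x [1..<N + 1]) ! (k - 1)"
proof -
  have "k \<noteq> 0" "k \<noteq> N + 1" using assms by linarith+
  then show ?thesis by (simp only: order_stat_def if_False)
qed

lemma order_stat_in_downset_iff:
  assumes down: "\<And>y z. y \<le> z \<Longrightarrow> z \<in> D \<Longrightarrow> y \<in> D" and k: "1 \<le> k" "k \<le> N"
  shows "order_stat l h N x k \<in> D \<longleftrightarrow> k \<le> card {j \<in> {1..N}. x j \<in> D}"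
proof -
  have "length (filter (\<lambda>y. y \<in> D) (map x [1..<N + 1])) = card {j \<in> {1..N}. x j \<in> D}"
  proof -
    have "length (filter (\<lambda>y. y \<in> D) (map x [1..<N + 1]))
        = length (filter (\<lambda>j. x j \<in> D) [1..<N + 1])"
      by (simp add: filter_map o_def del: upt_Suc)
    also have "\<dots> = card (set (filter (\<lambda>j. x j \<in> D) [1..<N + 1]))"
      by (rule distinct_card[symmetric]) simp
    also have "set (filter (\<lambda>j. x j \<in> D) [1..<N + 1]) = {j \<in> {1..N}. x j \<in> D}" by auto
    finally show ?thesis .
  qed
  then have "sort (map x [1..<N + 1]) ! (k - 1) \<in> D
      \<longleftrightarrow> k - 1 < card {j \<in> {1..N}. x j \<in> D}"
    using sort_nth_in_downset_iff[of D "k - 1" "map x [1..<N + 1]"] down k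
    by (simp only: length_map length_upt)
  moreover have "order_stat l h N x k = sort (map x [1..<N + 1]) ! (k - 1)"
    using k by (rule order_stat_eq_nth_sort)
  moreover have "k - 1 < c \<longleftrightarrow> k \<le> c" for c :: nat
    using k by auto
  ultimately show ?thesis by (simp only:)
qed

text \<open>The complement of an up-closed set is down-closed, so this is the previous equivalence negated: the
  \<open>k\<close>-th smallest of \<open>N\<close> values is the \<open>(N + 1 - k)\<close>-th largest.\<close>

lemma order_stat_in_upset_iff:
  assumes up: "\<And>y z. y \<le> z \<Longrightarrow> y \<in> U \<Longrightarrow> z \<in> U" and k: "1 \<le> k" "k \<le> N"
  shows "order_stat l h N x k \<in> U \<longleftrightarrow> N + 1 - k \<le> card {j \<in> {1..N}. x j \<in> U}"
proof -
  let ?C = "{j \<in> {1..N}. x j \<in> U}"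
  have "card {j \<in> {1..N}. x j \<in> - U} = card ({1..N} - ?C)"
    by (rule arg_cong[where f = card]) auto
  also have "\<dots> = card {1..N} - card ?C"
    by (rule card_Diff_subset) auto
  finally have "card {j \<in> {1..N}. x j \<in> - U} = N - card ?C" by simp
  moreover have "order_stat l h N x k \<in> - U \<longleftrightarrow> k \<le> card {j \<in> {1..N}. x j \<in> - U}"
    using up by (intro order_stat_in_downset_iff k) auto
  ultimately have "order_stat l h N x k \<in> U \<longleftrightarrow> \<not> k \<le> N - card ?C"
    by (simp only: Compl_iff) blast
  moreover have "card ?C \<le> card {1..N}"
    by (rule card_mono) auto
  moreover have "\<not> k \<le> N - c \<longleftrightarrow> N + 1 - k \<le> c" if "c \<le> N" for c
    using k that by auto
  ultimately show ?thesis by simp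
qed

lemma order_stat_mono:
  assumes "1 \<le> j" "j \<le> k" "k \<le> N"
  shows "order_stat l h N x j \<le> order_stat l h N x k"
proof -
  have "sort (map x [1..<N + 1]) ! (j - 1) \<le> sort (map x [1..<N + 1]) ! (k - 1)"
    using assms by (intro sorted_nth_mono sorted_sort) (auto simp del: upt_Suc)
  moreover have "order_stat l h N x j = sort (map x [1..<N + 1]) ! (j - 1)"
    "order_stat l h N x k = sort (map x [1..<N + 1]) ! (k - 1)"
    using assms by (intro order_stat_eq_nth_sort; linarith)+
  ultimately show ?thesis by (simp only:)
qed

text \<open>Whether an order statistic is at most \<open>c\<close> is decided by the number of observations that are.\<close>

lemma borel_measurable_order_stat:
  assumes X: "\<And>j. j \<in> {1..N} \<Longrightarrow> X j \<in> borel_measurable M" and k: "k \<le> N + 1"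
  shows "(\<lambda>\<omega>. order_stat l h N (\<lambda>j. X j \<omega>) k) \<in> borel_measurable M"
proof (cases "1 \<le> k \<and> k \<le> N")
  case True
  have count: "(\<lambda>\<omega>. \<Sum>j\<in>{1..N}. indicator {..c} (X j \<omega>) :: real) \<in> borel_measurable M" for c
    by (intro borel_measurable_sum measurable_compose[OF X borel_measurable_indicator]) auto
  have "{\<omega> \<in> space M. order_stat l h N (\<lambda>j. X j \<omega>) k \<in> {..c}} \<in> sets M" for c
  proof -
    have card_eq: "(\<Sum>j\<in>{1..N}. indicator {..c} (X j \<omega>)) = real (card {j \<in> {1..N}. X j \<omega> \<in> {..c}})" for \<omega>
    proof -
      have "(\<Sum>j\<in>{1..N}. indicator {..c} (X j \<omega>) :: real) = (\<Sum>j\<in>{j \<in> {1..N}. X j \<omega> \<in> {..c}}. 1)"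
        unfolding indicator_def of_bool_def by (rule sum.inter_filter[symmetric]) simp
      then show ?thesis by simp
    qed
    have iff: "order_stat l h N (\<lambda>j. X j \<omega>) k \<in> {..c} \<longleftrightarrow> k \<le> card {j \<in> {1..N}. X j \<omega> \<in> {..c}}" for \<omega>
      by (rule order_stat_in_downset_iff) (use True in auto)
    have "{\<omega> \<in> space M. real k \<le> (\<Sum>j\<in>{1..N}. indicator {..c} (X j \<omega>))} \<in> sets M"
      by (rule borel_measurable_le[OF borel_measurable_const count])
    then show ?thesis unfolding iff card_eq of_nat_le_iff .
  qed
  then show ?thesis by (simp add: borel_measurable_iff_le)
next
  case False
  then have "k = 0 \<or> k = N + 1" using k by auto
  then show ?thesis by (auto simp: order_stat_def)
qed

text \<open>The observations in \<open>D\<close> are counted by a binomial variable with success probability \<open>Q D\<close>. The bound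
  is stated with an upper bound \<open>q\<close> for \<open>Q D\<close> because, when \<open>Q\<close> has atoms, the prescribed level need
  not be attained.\<close>

lemma (in prob_space) prob_order_stat_downset_le:
  assumes indep: "indep_vars (\<lambda>_. borel) X {1..N}"
    and distr: "\<And>j. j \<in> {1..N} \<Longrightarrow> distr M borel (X j) = Q"
    and D: "\<And>y z. y \<le> z \<Longrightarrow> z \<in> D \<Longrightarrow> y \<in> D" "D \<in> sets borel" "measure Q D \<le> q"
    and q: "q \<le> 1" and k: "1 \<le> k" "k \<le> N"
  shows "prob {\<omega> \<in> space M. order_stat l h N (\<lambda>j. X j \<omega>) k \<in> D} \<le> binomial_tail N q k"
proof -
  have rv: "X j \<in> borel_measurable M" if "j \<in> {1..N}" for j
    using indep that by (auto simp: indep_vars_def)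
  have p: "prob (X j -` D \<inter> space M) = measure Q D" if "j \<in> {1..N}" for j
    using measure_distr[OF rv[OF that], of D] D distr[OF that] by simp
  have "prob {\<omega> \<in> space M. order_stat l h N (\<lambda>j. X j \<omega>) k \<in> D}
      = prob {\<omega> \<in> space M. k \<le> card {j \<in> {1..N}. X j \<omega> \<in> D}}"
    using order_stat_in_downset_iff[OF D(1) k] by simp
  also have "\<dots> = binomial_tail N (measure Q D) k"
    using prob_count_eq_binomial_tail[OF indep _ D(2) p] by simp
  also have "\<dots> \<le> binomial_tail N q k"
    using D(3) q by (intro binomial_tail_mono) auto
  finally show ?thesis .
qed

lemma (in prob_space) prob_order_stat_upset_le:
  assumes indep: "indep_vars (\<lambda>_. borel) X {1..N}"
    and distr: "\<And>j. j \<in> {1..N} \<Longrightarrow> distr M borel (X j) = Q"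
    and U: "\<And>y z. y \<le> z \<Longrightarrow> y \<in> U \<Longrightarrow> z \<in> U" "U \<in> sets borel" "measure Q U \<le> q"
    and q: "q \<le> 1" and k: "1 \<le> k" "k \<le> N"
  shows "prob {\<omega> \<in> space M. order_stat l h N (\<lambda>j. X j \<omega>) k \<in> U} \<le> binomial_tail N q (N + 1 - k)"
proof -
  have rv: "X j \<in> borel_measurable M" if "j \<in> {1..N}" for j
    using indep that by (auto simp: indep_vars_def)
  have p: "prob (X j -` U \<inter> space M) = measure Q U" if "j \<in> {1..N}" for j
    using measure_distr[OF rv[OF that], of U] U distr[OF that] by simp
  have "prob {\<omega> \<in> space M. order_stat l h N (\<lambda>j. X j \<omega>) k \<in> U}
      = prob {\<omega> \<in> space M. N + 1 - k \<le> card {j \<in> {1..N}. X j \<omega> \<in> U}}"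
    using order_stat_in_upset_iff[OF U(1) k] by simp
  also have "\<dots> = binomial_tail N (measure Q U) (N + 1 - k)"
    using prob_count_eq_binomial_tail[OF indep _ U(2) p] by simp
  also have "\<dots> \<le> binomial_tail N q (N + 1 - k)"
    using U(3) q by (intro binomial_tail_mono) auto
  finally show ?thesis .
qed

section \<open>Points with a large tail beyond them\<close>

text \<open>Inner regularity. It lets suprema and limits be replaced by extrema that are attained on a compact
  subset.\<close>

lemma measure_le_if_compact_le:
  fixes Q :: "'a::{second_countable_topology, complete_space} measure"
  assumes Q: "finite_measure Q" "sets Q = sets borel" and D: "D \<in> sets borel"
    and c: "0 \<le> c" "\<And>K. compact K \<Longrightarrow> K \<noteq> {} \<Longrightarrow> K \<subseteq> D \<Longrightarrow> measure Q K \<le> c"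
  shows "measure Q D \<le> c"
proof -
  interpret finite_measure Q by fact
  have "emeasure Q D = (SUP K \<in> {K. K \<subseteq> D \<and> compact K}. emeasure Q K)"
    using inner_regular[OF Q(2) _ D] emeasure_finite by simp
  also have "\<dots> \<le> ennreal c"
  proof (intro SUP_least)
    fix K assume "K \<in> {K. K \<subseteq> D \<and> compact K}"
    then show "emeasure Q K \<le> ennreal c"
      using c by (cases "K = {}") (auto simp: emeasure_eq_measure intro!: ennreal_leI)
  qed
  finally show ?thesis using c by (simp add: emeasure_eq_measure)
qed

text \<open>The bound on the measure: a nonempty compact \<open>K \<subseteq> D\<close> has a largest element \<open>x \<in> D\<close>, so \<open>K\<close> misses
  \<open>{x<..}\<close>, whose measure exceeds \<open>\<eta>\<close>. No quantile has to be chosen, and atoms need no special care.\<close>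

lemma large_upper_tail_downset:
  fixes Q :: "real measure"
  assumes Q: "prob_space Q" "sets Q = sets borel" and \<eta>: "\<eta> \<le> 1"
  defines "D \<equiv> {x. \<eta> < measure Q {x<..}}"
  shows "y \<le> z \<Longrightarrow> z \<in> D \<Longrightarrow> y \<in> D" "D \<in> sets borel" "measure Q D \<le> 1 - \<eta>"
proof -
  interpret prob_space Q by fact
  have sp: "space Q = UNIV" using sets_eq_imp_space_eq[OF Q(2)] by simp
  show down: "y \<in> D" if "y \<le> z" "z \<in> D" for y z
    using that finite_measure_mono[of "{z<..}" "{y<..}"] by (auto simp: D_def Q)
  show D: "D \<in> sets borel"
    by (rule real_interval_borel_measurable) (auto simp: is_interval_1 intro: down)
  show "measure Q D \<le> 1 - \<eta>"
  proof (rule measure_le_if_compact_le[OF finite_measure_axioms Q(2) D])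
    fix K :: "real set" assume K: "compact K" "K \<noteq> {}" "K \<subseteq> D"
    from compact_attains_sup[OF K(1,2)] obtain x where x: "x \<in> K" "K \<subseteq> {..x}" by auto
    have "measure Q K \<le> measure Q {..x}"
      using x by (intro finite_measure_mono) (auto simp: Q)
    also have "{..x} = space Q - {x<..}" by (auto simp: sp)
    also have "measure Q \<dots> = 1 - measure Q {x<..}" by (intro prob_compl) (auto simp: Q)
    also have "\<dots> \<le> 1 - \<eta>" using x K by (auto simp: D_def)
    finally show "measure Q K \<le> 1 - \<eta>" .
  qed (use \<eta> in simp)
qed

lemma large_lower_tail_upset:
  fixes Q :: "real measure"
  assumes Q: "prob_space Q" "sets Q = sets borel" and \<eta>: "\<eta> \<le> 1"
  defines "U \<equiv> {x. \<eta> < measure Q {..<x}}"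
  shows "y \<le> z \<Longrightarrow> y \<in> U \<Longrightarrow> z \<in> U" "U \<in> sets borel" "measure Q U \<le> 1 - \<eta>"
proof -
  interpret prob_space Q by fact
  have sp: "space Q = UNIV" using sets_eq_imp_space_eq[OF Q(2)] by simp
  show up: "z \<in> U" if "y \<le> z" "y \<in> U" for y z
    using that finite_measure_mono[of "{..<y}" "{..<z}"] by (auto simp: U_def Q)
  show U: "U \<in> sets borel"
    by (rule real_interval_borel_measurable) (auto simp: is_interval_1 intro: up)
  show "measure Q U \<le> 1 - \<eta>"
  proof (rule measure_le_if_compact_le[OF finite_measure_axioms Q(2) U])
    fix K :: "real set" assume K: "compact K" "K \<noteq> {}" "K \<subseteq> U"
    from compact_attains_inf[OF K(1,2)] obtain x where x: "x \<in> K" "K \<subseteq> {x..}" by auto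
    have "measure Q K \<le> measure Q {x..}"
      using x by (intro finite_measure_mono) (auto simp: Q)
    also have "{x..} = space Q - {..<x}" by (auto simp: sp)
    also have "measure Q \<dots> = 1 - measure Q {..<x}" by (intro prob_compl) (auto simp: Q)
    also have "\<dots> \<le> 1 - \<eta>" using x K by (auto simp: U_def)
    finally show "measure Q K \<le> 1 - \<eta>" .
  qed (use \<eta> in simp)
qed

section \<open>Support functions of boxes\<close>

definition box_support :: "real ^ 'n \<Rightarrow> real ^ 'n \<Rightarrow> real ^ 'n::finite \<Rightarrow> real" where
  "box_support v a b = (\<Sum>i\<in>UNIV. max (v $ i * a $ i) (v $ i * b $ i))"

lemma inner_le_box_support:
  assumes "u \<in> cbox a b"
  shows "v \<bullet> u \<le> box_support v a b"
  unfolding inner_vec_def box_support_def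
proof (intro sum_mono)
  fix i
  have "a $ i \<le> u $ i" "u $ i \<le> b $ i" using assms by (auto simp: mem_box_cart)
  then show "v $ i \<bullet> u $ i \<le> max (v $ i * a $ i) (v $ i * b $ i)"
    by (cases "0 \<le> v $ i") (auto simp: le_max_iff_disj intro: mult_left_mono mult_left_mono_neg)
qed

lemma box_support_attained:
  assumes "\<And>i. a $ i \<le> b $ i"
  obtains u where "u \<in> cbox a b" "v \<bullet> u = box_support v a b"
proof
  let ?u = "\<chi> i. if 0 \<le> v $ i then b $ i else a $ i"
  show "?u \<in> cbox a b" using assms by (auto simp: mem_box_cart)
  show "v \<bullet> ?u = box_support v a b"
    unfolding inner_vec_def box_support_def
  proof (intro sum.cong refl)
    fix i
    have "v $ i * a $ i \<le> v $ i * b $ i" if "0 \<le> v $ i"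
      using assms that by (rule mult_left_mono)
    moreover have "v $ i * b $ i \<le> v $ i * a $ i" if "\<not> 0 \<le> v $ i"
      using assms that by (intro mult_left_mono_neg) auto
    ultimately show "v $ i \<bullet> ?u $ i = max (v $ i * a $ i) (v $ i * b $ i)" by (auto simp: max_def)
  qed
qed

lemma support_fun_cbox:
  assumes "\<And>i. a $ i \<le> b $ i"
  shows "support_fun v (cbox a b) = ereal (box_support v a b)"
  unfolding support_fun_def
proof (rule antisym)
  show "(SUP u\<in>cbox a b. ereal (v \<bullet> u)) \<le> ereal (box_support v a b)"
    by (intro SUP_least) (simp add: inner_le_box_support)
  obtain u where u: "u \<in> cbox a b" "v \<bullet> u = box_support v a b"
    using box_support_attained[OF assms] .
  show "ereal (box_support v a b) \<le> (SUP u\<in>cbox a b. ereal (v \<bullet> u))"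
    using u by (intro SUP_upper2[of u]) auto
qed

section \<open>The halfspace criterion\<close>

text \<open>One direction tests the guarantee with an affine function. The other separates the box from the
  open convex set where the concave function is positive; as the support function is attained in the
  box, the separating hyperplane can be moved back until it touches the box.\<close>

lemma implies_guarantee_cbox_iff:
  fixes P :: "(real ^ 'n::finite) measure"
  assumes P: "prob_space P" "sets P = sets borel" and ab: "\<And>i. a $ i \<le> b $ i"
  shows "implies_guarantee TYPE('k::finite) P \<epsilon> (cbox a b) \<longleftrightarrow>
    (\<forall>v. measure P {u. box_support v a b < v \<bullet> u} \<le> \<epsilon>)"
proof -
  interpret prob_space P by fact
  have sp: "space P = UNIV" using sets_eq_imp_space_eq[OF P(2)] by simp
  have prob_le_0: "prob {u. g u \<le> 0} = 1 - prob {u. 0 < g u}"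
    if "continuous_on UNIV g" for g :: "real ^ 'n \<Rightarrow> real"
  proof -
    have "open {u. 0 < g u}" using that by (simp add: open_Collect_less)
    then have "{u. 0 < g u} \<in> events" by (simp add: P)
    then show ?thesis using prob_compl[of "{u. 0 < g u}"] by (simp add: sp Compl_eq_Diff_UNIV[symmetric] Collect_neg_eq[symmetric] not_less)
  qed
  show ?thesis
  proof
    assume G: "implies_guarantee TYPE('k) P \<epsilon> (cbox a b)"
    show "\<forall>v. measure P {u. box_support v a b < v \<bullet> u} \<le> \<epsilon>"
    proof
      fix v
      \<comment> \<open>A function independent of the decision variable is an admissible test function.\<close>
      define g where "g u = v \<bullet> u - box_support v a b" for u
      have "concave_on UNIV g"
        unfolding concave_on_iff g_def
        by (auto simp: inner_add_right algebra_simps simp flip: distrib_left distrib_right)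
      moreover have "\<forall>u\<in>cbox a b. g u \<le> 0" by (simp add: g_def inner_le_box_support)
      ultimately have "1 - \<epsilon> \<le> prob {u. g u \<le> 0}"
        using G[unfolded implies_guarantee_def, rule_format, of "\<lambda>u _. g u"] by (simp add: sp)
      also have "\<dots> = 1 - prob {u. 0 < g u}"
        unfolding g_def by (intro prob_le_0 continuous_intros)
      finally show "measure P {u. box_support v a b < v \<bullet> u} \<le> \<epsilon>" by (simp add: g_def)
    qed
  next
    assume H: "\<forall>v. measure P {u. box_support v a b < v \<bullet> u} \<le> \<epsilon>"
    show "implies_guarantee TYPE('k) P \<epsilon> (cbox a b)"
      unfolding implies_guarantee_def
    proof (intro allI impI)
      fix x :: "real ^ 'k" and f :: "real ^ 'n \<Rightarrow> real ^ 'k \<Rightarrow> real"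
      assume "\<forall>y. concave_on UNIV (\<lambda>u. f u y)" and le: "\<forall>u\<in>cbox a b. f u x \<le> 0"
      then have conc: "concave_on UNIV (\<lambda>u. f u x)" by blast
      let ?T = "{u. 0 < f u x}"
      have "continuous_on UNIV (\<lambda>u. - f u x)"
        using conc by (intro convex_on_continuous) (auto simp: concave_on_def)
      then have cont: "continuous_on UNIV (\<lambda>u. f u x)"
        using continuous_on_minus by fastforce
      have "open ?T" using cont by (simp add: open_Collect_less)
      have "convex ?T"
        unfolding convex_def
      proof (intro ballI allI impI)
        fix y z and s t :: real assume *: "y \<in> ?T" "z \<in> ?T" "0 \<le> s" "0 \<le> t" "s + t = 1"
        then have "0 < s * f y x + t * f z x"
          by (cases "s = 0") (auto intro!: add_pos_nonneg)
        also have "\<dots> \<le> f (s *\<^sub>R y + t *\<^sub>R z) x"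
          using conc * unfolding concave_on_iff by blast
        finally show "s *\<^sub>R y + t *\<^sub>R z \<in> ?T" by simp
      qed
      have "prob ?T \<le> \<epsilon>"
      proof (cases "?T = {}")
        case True
        have "0 \<le> \<epsilon>" using H measure_nonneg order_trans by blast
        then show ?thesis by (subst True) simp
      next
        case False
        have "cbox a b \<noteq> {}" using box_support_attained[OF ab] by blast
        moreover have "cbox a b \<inter> ?T = {}" using le by force
        ultimately obtain v c where v: "v \<noteq> 0" "\<forall>u\<in>cbox a b. v \<bullet> u \<le> c" "\<forall>u\<in>?T. c \<le> v \<bullet> u"
          using separating_hyperplane_sets[OF _ \<open>convex ?T\<close> _ False, of "cbox a b"] by auto
        have "box_support v a b \<le> c"
          using box_support_attained[OF ab, of v] v(2) by metis
        have "?T \<subseteq> {u. box_support v a b < v \<bullet> u}"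
        proof
          fix u assume u: "u \<in> ?T"
          \<comment> \<open>As \<open>?T\<close> is open, it extends below \<open>u\<close> in direction \<open>v\<close>: the separation is strict on \<open>?T\<close>.\<close>
          then obtain e where e: "0 < e" "ball u e \<subseteq> ?T"
            using \<open>open ?T\<close> by (meson open_contains_ball)
          \<comment> \<open>Any step shorter than \<open>e\<close> against \<open>v\<close> would do; this one has length \<open>e / 2\<close>.\<close>
          let ?w = "u - (e / (2 * norm v)) *\<^sub>R v"
          have "?w \<in> ball u e" using e v(1) by (simp add: dist_norm)
          then have "c \<le> v \<bullet> ?w" using e v(3) by blast
          also have "\<dots> < v \<bullet> u" using e v(1) by (simp add: inner_diff_right)
          finally show "u \<in> {u. box_support v a b < v \<bullet> u}" using \<open>box_support v a b \<le> c\<close> by simp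
        qed
        then have "prob ?T \<le> prob {u. box_support v a b < v \<bullet> u}"
          by (intro finite_measure_mono) (auto simp: P intro!: borel_open open_Collect_less continuous_intros)
        then show ?thesis using H by (meson order_trans)
      qed
      then show "1 - \<epsilon> \<le> \<P>(u in P. f u x \<le> 0)"
        using prob_le_0[OF cont] by (simp add: sp)
    qed
  qed
qed

text \<open>Right continuity of \<open>t \<mapsto> P (g > t)\<close>, in the form of an open complement: if \<open>P (g > t) > c\<close>, a compact
  \<open>K \<subseteq> {g > t}\<close> already has measure above \<open>c\<close>, and \<open>K \<subseteq> {g > r}\<close> for all \<open>r\<close> below the minimum of \<open>g\<close>
  on \<open>K\<close>.\<close>

lemma closed_superlevel_prob_le:
  fixes g :: "'a::{second_countable_topology, complete_space} \<Rightarrow> real"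
  assumes P: "finite_measure P" "sets P = sets borel" and g: "continuous_on UNIV g"
  shows "closed {t. measure P {u. t < g u} \<le> c}"
proof -
  interpret finite_measure P by fact
  have sets: "{u. t < g u} \<in> sets P" for t
    using g by (auto simp: P intro!: borel_open open_Collect_less)
  have "open {t. c < measure P {u. t < g u}}"
  proof (rule openI)
    fix t assume t: "t \<in> {t. c < measure P {u. t < g u}}"
    show "\<exists>e>0. ball t e \<subseteq> {t. c < measure P {u. t < g u}}"
    proof (cases "0 \<le> c")
      case False
      then have "c < measure P {u. r < g u}" for r by (simp add: less_le_trans[OF _ measure_nonneg])
      then show ?thesis by (intro exI[of _ 1]) simp
    next
      case True
      then obtain K where K: "compact K" "K \<noteq> {}" "K \<subseteq> {u. t < g u}" "c < measure P K"
        using measure_le_if_compact_le[OF P, of "{u. t < g u}" c] sets t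
        by (auto simp: P not_le[symmetric])
      obtain m where m: "m \<in> K" "\<And>u. u \<in> K \<Longrightarrow> g m \<le> g u"
        using continuous_attains_inf[OF K(1,2) continuous_on_subset[OF g]] by auto
      have "c < measure P {u. r < g u}" if "r \<in> ball t (g m - t)" for r
      proof -
        have "K \<subseteq> {u. r < g u}" using m(2) that by (fastforce simp: dist_real_def)
        then show ?thesis using K(4) finite_measure_mono[OF _ sets] less_le_trans by blast
      qed
      moreover have "0 < g m - t" using m K by auto
      ultimately show ?thesis by blast
    qed
  qed
  moreover have "{t. measure P {u. t < g u} \<le> c} = - {t. c < measure P {u. t < g u}}" by auto
  ultimately show ?thesis by (simp add: closed_def)
qed

text \<open>For each \<open>v\<close> the condition is a closed condition on the value of the support function, which depends
  continuously on the corners; an intersection of closed sets is closed even over uncountably many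
  \<open>v\<close>.\<close>

lemma closed_halfspace_guarantee:
  fixes P :: "(real ^ 'n::finite) measure"
  assumes P: "finite_measure P" "sets P = sets borel"
  shows "closed {(a, b). \<forall>v. measure P {u. box_support v a b < v \<bullet> u} \<le> \<epsilon>}"
proof -
  have "closed ((\<lambda>(a, b). box_support v a b) -` {t. measure P {u. t < v \<bullet> u} \<le> \<epsilon>})" for v
  proof (rule continuous_closed_vimage)
    show "closed {t. measure P {u. t < v \<bullet> u} \<le> \<epsilon>}"
      by (intro closed_superlevel_prob_le P continuous_intros)
    show "isCont (\<lambda>(a, b). box_support v a b) z" for z
      unfolding box_support_def case_prod_beta by (intro continuous_intros)
  qed
  then have "closed (\<Inter>v. (\<lambda>(a, b). box_support v a b) -` {t. measure P {u. t < v \<bullet> u} \<le> \<epsilon>})"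
    by blast
  also have "(\<Inter>v. (\<lambda>(a, b). box_support v a b) -` {t. measure P {u. t < v \<bullet> u} \<le> \<epsilon>})
      = {(a, b). \<forall>v. measure P {u. box_support v a b < v \<bullet> u} \<le> \<epsilon>}"
    by auto
  finally show ?thesis .
qed

text \<open>Only one of the two tails matters in each coordinate, namely the one that the sign of \<open>v $ i\<close>
  selects; hence the union bound costs \<open>d\<close> terms and not \<open>2 d\<close>.\<close>

lemma halfspace_prob_le_if_marginal_tails:
  fixes P :: "(real ^ 'n::finite) measure"
  assumes P: "prob_space P" "sets P = sets borel" and ab: "\<And>i. a $ i \<le> b $ i"
    and lower: "\<And>i. measure P {u. u $ i < a $ i} \<le> \<epsilon> / CARD('n)"
    and upper: "\<And>i. measure P {u. b $ i < u $ i} \<le> \<epsilon> / CARD('n)"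
  shows "measure P {u. box_support v a b < v \<bullet> u} \<le> \<epsilon>"
proof -
  interpret prob_space P by fact
  let ?A = "\<lambda>i. {u. max (v $ i * a $ i) (v $ i * b $ i) < v $ i * u $ i}"
  have sets: "{u. g u < h u} \<in> events"
    if "continuous_on UNIV g" "continuous_on UNIV h" for g h :: "real ^ 'n \<Rightarrow> real"
    using that by (auto simp: P intro!: borel_open open_Collect_less)
  have A: "?A i \<in> events" for i by (intro sets continuous_intros)
  have "prob (?A i) \<le> \<epsilon> / CARD('n)" for i
  proof -
    consider "v $ i = 0" | "0 < v $ i" | "v $ i < 0" by linarith
    then show ?thesis
    proof cases
      case 1
      then show ?thesis using order_trans[OF measure_nonneg lower] by simp
    next
      case 2
      then have "prob (?A i) \<le> prob {u. b $ i < u $ i}"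
        by (intro finite_measure_mono sets continuous_intros) (auto simp: mult_less_cancel_left_pos)
      then show ?thesis using upper order_trans by blast
    next
      case 3
      then have "prob (?A i) \<le> prob {u. u $ i < a $ i}"
        by (intro finite_measure_mono sets continuous_intros) (auto simp: mult_less_cancel_left_neg)
      then show ?thesis using lower order_trans by blast
    qed
  qed
  then have sum: "(\<Sum>i\<in>UNIV. prob (?A i)) \<le> \<epsilon>"
    using sum_mono[of UNIV "\<lambda>i. prob (?A i)" "\<lambda>_. \<epsilon> / CARD('n)"] by simp
  have "{u. box_support v a b < v \<bullet> u} \<subseteq> (\<Union>i. ?A i)"
  proof (rule subsetI, rule ccontr)
    fix u assume u: "u \<in> {u. box_support v a b < v \<bullet> u}" "u \<notin> (\<Union>i. ?A i)"
    then have "v \<bullet> u \<le> box_support v a b"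
      unfolding box_support_def inner_vec_def by (intro sum_mono) (simp add: not_less le_max_iff_disj)
    then show False using u by simp
  qed
  then have "prob {u. box_support v a b < v \<bullet> u} \<le> prob (\<Union>i. ?A i)"
    using A by (intro finite_measure_mono) auto
  also have "\<dots> \<le> (\<Sum>i\<in>UNIV. prob (?A i))"
    using A by (intro finite_measure_subadditive_finite) auto
  finally show ?thesis using sum by simp
qed

section \<open>The data-driven box\<close>

text \<open>The two cases differ in kind: if no rank is admissible, the box is bounded by the known bounds of the
  support and no sample enters; otherwise the minimum is attained and satisfies its defining
  inequality.\<close>

lemma s_index_cases:
  assumes "s = s_index \<alpha> \<epsilon> d N"
  obtains "s = N + 1"
    | "1 \<le> s" "s \<le> N" "binomial_tail N (1 - \<epsilon> / real d) s \<le> \<alpha> / (2 * real d)"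
proof -
  let ?K = "{k \<in> {1..N}. (\<Sum>j=k..N. real (N choose j) * (\<epsilon> / real d) ^ (N - j) * (1 - \<epsilon> / real d) ^ j)
      \<le> \<alpha> / (2 * real d)}"
  show ?thesis
  proof (cases "?K = {}")
    case True
    then have "s = N + 1" using assms unfolding s_index_def Let_def by (rule if_P[THEN trans[rotated]])
    then show ?thesis by (rule that(1))
  next
    case False
    then have "s = Min ?K" using assms by (simp only: s_index_def Let_def if_False)
    then have "s \<in> ?K" using Min_in[of ?K] False by simp
    then show ?thesis by (intro that(2)) (simp_all add: binomial_tail_def)
  qed
qed


theorem theorem7:
  fixes P :: "(real ^ 'n::finite) measure"
    and M :: "'o measure"
    and X :: "'n \<Rightarrow> nat \<Rightarrow> 'o \<Rightarrow> real"
    and lo hi :: "real ^ 'n"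
    and \<alpha> \<epsilon> :: real
    and N s :: nat
  assumes "0 < \<alpha>" "\<alpha> < 1" "0 < \<epsilon>" "\<epsilon> < 1"
    and "prob_space P" "sets P = sets borel"
    and "AE u in P. \<forall>i. lo $ i \<le> u $ i \<and> u $ i \<le> hi $ i"
    and "prob_space M"
    and "\<And>i. prob_space.indep_vars M (\<lambda>_. borel) (X i) {1..N}"
    and "\<And>i j. j \<in> {1..N} \<Longrightarrow> distr M borel (X i j) = marginal P i"
    and "s = s_index \<alpha> \<epsilon> CARD('n) N"
    and "N + 1 - s < s"
  shows "\<P>(\<omega> in M. implies_guarantee TYPE('k::finite) P \<epsilon> (U_M lo hi N s (\<lambda>i j. X i j \<omega>))) \<ge> 1 - \<alpha>
    \<and> (\<forall>\<omega> \<in> space M. \<forall>v :: real ^ 'n.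
          support_fun v (U_M lo hi N s (\<lambda>i j. X i j \<omega>)) =
            ereal (\<Sum>i\<in>UNIV. max (v $ i * order_stat (lo $ i) (hi $ i) N (\<lambda>j. X i j \<omega>) (N + 1 - s))
                                (v $ i * order_stat (lo $ i) (hi $ i) N (\<lambda>j. X i j \<omega>) s)))"
proof -
  interpret P: prob_space P by fact
  interpret M: prob_space M by fact
  define d where "d = real CARD('n)"
  have "1 \<le> CARD('n)" by (simp add: Suc_leI)
  then have d: "1 \<le> d" unfolding d_def by linarith
  define \<eta> where "\<eta> = \<epsilon> / d"
  have \<eta>: "0 < \<eta>" "\<eta> \<le> 1" using assms(3,4) d by (auto simp: \<eta>_def divide_le_eq)
  define a where "a i \<omega> = order_stat (lo $ i) (hi $ i) N (\<lambda>j. X i j \<omega>) (N + 1 - s)" for i \<omega>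
  define b where "b i \<omega> = order_stat (lo $ i) (hi $ i) N (\<lambda>j. X i j \<omega>) s" for i \<omega>
  have U_M_eq: "U_M lo hi N s (\<lambda>i j. X i j \<omega>) = cbox (\<chi> i. a i \<omega>) (\<chi> i. b i \<omega>)" for \<omega>
    by (auto simp: U_M_def a_def b_def mem_box_cart)
  consider (bounds) "s = N + 1"
    | (observed) "1 \<le> s" "s \<le> N" "binomial_tail N (1 - \<eta>) s \<le> \<alpha> / (2 * d)"
    using s_index_cases[OF assms(11)] unfolding \<eta>_def d_def by blast
  note s_cases = this
  have bounds_eq: "a i \<omega> = lo $ i" "b i \<omega> = hi $ i" if "s = N + 1" for i \<omega>
    using that by (simp_all add: a_def b_def order_stat_def)
  \<comment> \<open>In the boundary case the order of the bounds follows from the support having mass one.\<close>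
  have ab: "a i \<omega> \<le> b i \<omega>" for i \<omega>
    using s_cases
  proof cases
    case bounds
    have "AE u in P. lo $ i \<le> hi $ i"
      using assms(7) by eventually_elim (meson order_trans)
    then show ?thesis using bounds_eq[OF bounds] by simp
  next
    case observed
    then show ?thesis unfolding a_def b_def using assms(12) by (intro order_stat_mono) auto
  qed

  have X: "X i j \<in> borel_measurable M" if "j \<in> {1..N}" for i j
    using assms(9)[of i] that by (auto simp: M.indep_vars_def)
  have s_le: "s \<le> N + 1" using s_cases by cases auto
  have meas: "a i \<in> borel_measurable M" "b i \<in> borel_measurable M" for i
    unfolding a_def b_def using s_le by (intro borel_measurable_order_stat X; simp)+

  have proj: "(\<lambda>u. u $ i) \<in> borel_measurable P" for i
    unfolding measurable_cong_sets[OF assms(6) refl]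
    by (intro borel_measurable_continuous_onI continuous_intros)
  have marginal: "prob_space (marginal P i)" "sets (marginal P i) = sets borel" for i
    unfolding marginal_def by (auto intro: P.prob_space_distr proj)
  have tails: "measure P {u. u $ i < x} = measure (marginal P i) {..<x}"
    "measure P {u. x < u $ i} = measure (marginal P i) {x<..}" for i x
    using sets_eq_imp_space_eq[OF assms(6)]
    by (simp_all add: marginal_def measure_distr[OF proj] vimage_def)

  \<comment> \<open>\<open>D i\<close> and \<open>U i\<close> collect the upper and lower endpoints that leave too much mass outside.\<close>
  define D where "D i = {x. \<eta> < measure (marginal P i) {x<..}}" for i
  define U where "U i = {x. \<eta> < measure (marginal P i) {..<x}}" for i
  note D = large_upper_tail_downset[OF marginal \<eta>(2), folded D_def]
  note U = large_lower_tail_upset[OF marginal \<eta>(2), folded U_def]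
  have bad_sets: "{\<omega> \<in> space M. b i \<omega> \<in> D i} \<in> sets M" "{\<omega> \<in> space M. a i \<omega> \<in> U i} \<in> sets M" for i
    using measurable_sets[OF meas(2) D(2)] measurable_sets[OF meas(1) U(2)]
    by (simp_all add: vimage_def Int_def conj_commute)
  have bad_le: "M.prob {\<omega> \<in> space M. b i \<omega> \<in> D i} \<le> \<alpha> / (2 * d) \<and>
      M.prob {\<omega> \<in> space M. a i \<omega> \<in> U i} \<le> \<alpha> / (2 * d)" for i
    using s_cases
  proof cases
    case bounds
    have "AE u in P. \<not> u $ i < lo $ i" "AE u in P. \<not> hi $ i < u $ i"
      using assms(7) by (auto elim!: eventually_mono simp: not_less)
    then have "measure P {u. u $ i < lo $ i} = 0" "measure P {u. hi $ i < u $ i} = 0"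
      using P.prob_Collect_eq_0[of "\<lambda>u. u $ i < lo $ i"] P.prob_Collect_eq_0[of "\<lambda>u. hi $ i < u $ i"]
        borel_measurable_less[OF proj[of i] borel_measurable_const, of "lo $ i"]
        borel_measurable_less[OF borel_measurable_const proj[of i], of "hi $ i"]
        sets_eq_imp_space_eq[OF assms(6)] by simp_all
    then have "b i \<omega> \<notin> D i" "a i \<omega> \<notin> U i" for \<omega>
      using \<eta> bounds_eq[OF bounds] by (auto simp: D_def U_def tails)
    then show ?thesis using assms(1) d by simp
  next
    case observed
    have "M.prob {\<omega> \<in> space M. b i \<omega> \<in> D i} \<le> binomial_tail N (1 - \<eta>) s"
      unfolding b_def
      by (rule M.prob_order_stat_downset_le[OF assms(9,10) D]) (use \<eta> observed in auto)
    moreover have "M.prob {\<omega> \<in> space M. a i \<omega> \<in> U i} \<le> binomial_tail N (1 - \<eta>) (N + 1 - (N + 1 - s))"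
      unfolding a_def
      by (rule M.prob_order_stat_upset_le[OF assms(9,10) U]) (use \<eta> observed in auto)
    moreover have "N + 1 - (N + 1 - s) = s" using observed by simp
    ultimately show ?thesis using observed(3) by simp
  qed

  \<comment> \<open>Some endpoint is bad: a union bound over \<open>2 d\<close> events of probability at most \<open>\<alpha> / (2 d)\<close>.\<close>
  define Bad where "Bad = (\<Union>i. {\<omega> \<in> space M. b i \<omega> \<in> D i} \<union> {\<omega> \<in> space M. a i \<omega> \<in> U i})"
  have Bad_sets: "Bad \<in> sets M" unfolding Bad_def using bad_sets by auto
  have "M.prob Bad \<le> (\<Sum>i\<in>UNIV. M.prob ({\<omega> \<in> space M. b i \<omega> \<in> D i} \<union> {\<omega> \<in> space M. a i \<omega> \<in> U i}))"
    unfolding Bad_def using bad_sets by (intro M.finite_measure_subadditive_finite) auto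
  also have "\<dots> \<le> (\<Sum>i\<in>(UNIV :: 'n set). \<alpha> / d)"
  proof (intro sum_mono)
    fix i
    have "M.prob ({\<omega> \<in> space M. b i \<omega> \<in> D i} \<union> {\<omega> \<in> space M. a i \<omega> \<in> U i})
        \<le> \<alpha> / (2 * d) + \<alpha> / (2 * d)"
      using measure_Un_le[OF bad_sets] bad_le[of i] by (meson add_mono order_trans)
    then show "M.prob ({\<omega> \<in> space M. b i \<omega> \<in> D i} \<union> {\<omega> \<in> space M. a i \<omega> \<in> U i}) \<le> \<alpha> / d"
      by simp
  qed
  also have "\<dots> = \<alpha>" using d by (simp flip: d_def)
  finally have prob_Bad: "M.prob Bad \<le> \<alpha>" .

  define Good where
    "Good = {\<omega> \<in> space M. implies_guarantee TYPE('k) P \<epsilon> (U_M lo hi N s (\<lambda>i j. X i j \<omega>))}"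
  have guarantee_iff: "implies_guarantee TYPE('k) P \<epsilon> (U_M lo hi N s (\<lambda>i j. X i j \<omega>)) \<longleftrightarrow>
      (\<forall>v. measure P {u. box_support v (\<chi> i. a i \<omega>) (\<chi> i. b i \<omega>) < v \<bullet> u} \<le> \<epsilon>)" for \<omega>
    unfolding U_M_eq using ab by (intro implies_guarantee_cbox_iff assms(5,6)) simp
  \<comment> \<open>The preimage of a closed set of pairs of corners under a measurable map.\<close>
  have "Good \<in> sets M"
  proof -
    let ?C = "{(a, b). \<forall>v. measure P {u. box_support v a b < v \<bullet> u} \<le> \<epsilon>}"
    have vec: "(\<lambda>\<omega>. \<chi> i. f i \<omega>) \<in> borel_measurable M"
      if f: "\<And>i. f i \<in> borel_measurable M" for f :: "'n \<Rightarrow> 'o \<Rightarrow> real"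
      unfolding borel_measurable_euclidean_space[where 'c = "real ^ 'n"]
    proof
      fix e :: "real ^ 'n" assume "e \<in> Basis"
      then obtain i where "e = axis i 1" by (auto simp: Basis_vec_def)
      then show "(\<lambda>\<omega>. (\<chi> i. f i \<omega>) \<bullet> e) \<in> borel_measurable M" using f by (simp add: inner_axis)
    qed
    let ?corners = "\<lambda>\<omega>. (\<chi> i. a i \<omega>, \<chi> i. b i \<omega>)"
    have "?C \<in> sets borel"
      by (intro borel_closed closed_halfspace_guarantee P.finite_measure_axioms assms(6))
    moreover have "?corners \<in> borel_measurable M"
      by (intro borel_measurable_Pair vec meas)
    ultimately have "?corners -` ?C \<inter> space M \<in> sets M" by (intro measurable_sets)
    also have "?corners -` ?C \<inter> space M = Good"
      unfolding Good_def guarantee_iff by blast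
    finally show ?thesis .
  qed
  moreover have "space M - Bad \<subseteq> Good"
  proof
    fix \<omega> assume "\<omega> \<in> space M - Bad"
    then have \<omega>: "\<omega> \<in> space M" and "b i \<omega> \<notin> D i" "a i \<omega> \<notin> U i" for i by (auto simp: Bad_def)
    then have "measure P {u. u $ i < a i \<omega>} \<le> \<epsilon> / d" "measure P {u. b i \<omega> < u $ i} \<le> \<epsilon> / d" for i
      by (auto simp: D_def U_def tails not_less \<eta>_def)
    then have "\<forall>v. measure P {u. box_support v (\<chi> i. a i \<omega>) (\<chi> i. b i \<omega>) < v \<bullet> u} \<le> \<epsilon>"
      unfolding d_def using ab by (intro allI halfspace_prob_le_if_marginal_tails assms(5,6)) simp_all
    then show "\<omega> \<in> Good" unfolding Good_def guarantee_iff using \<omega> by simp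
  qed
  ultimately have "M.prob (space M - Bad) \<le> M.prob Good"
    by (intro M.finite_measure_mono)
  then have "1 - \<alpha> \<le> M.prob Good"
    using prob_Bad M.prob_compl[OF Bad_sets] by simp
  moreover have "support_fun v (U_M lo hi N s (\<lambda>i j. X i j \<omega>))
      = ereal (\<Sum>i\<in>UNIV. max (v $ i * a i \<omega>) (v $ i * b i \<omega>))" for v \<omega>
    unfolding U_M_eq using ab by (subst support_fun_cbox) (simp_all add: box_support_def)
  ultimately show ?thesis unfolding Good_def a_def b_def by blast
qed

end
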